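(* Let $n\ge1$, and for a function $F:\{0,1\}^n\to\{0,1\}^n$ and $k\in\{0,1\}^n$ let $E_k[F](x)=F(x\oplus k)$. Let $\mathcal A$ be a quantum algorithm making $q_E$ classical queries to its first oracle and $q_F$ quantum queries to its second oracle. Then $$\left|\Pr_{k\leftarrow\{0,1\}^n,\;F\leftarrow\mathcal F_n}\left[\mathcal A^{E_k[F],F}(1^n)=1\right]-\Pr_{R,F\leftarrow\mathcal F_n}\left[\mathcal A^{R,F}(1^n)=1\right]\right|\le 2^{-n/2}\cdot\left(2q_E\sqrt{q_F}+2q_F\sqrt{q_E}\right).$$
   Context: $\mathcal F_n$ is the set of all functions from $\{0,1\}^n$ to $\{0,1\}^n$; all samplings are uniform and independent. $\mathcal A^{O_1,O_2}$ denotes an execution of a (computationally unbounded) quantum algorithm with forward-only access to two functions $O_1,O_2:\{0,1\}^n\to\{0,1\}^n$. Access to $O_1$ is classical (a query is a classical string $x$, answered by $O_1(x)$); access to $O_2$ is quantum (a query applies the unitary $|x\rangle|y\rangle\mapsto|x\rangle|y\oplus O_2(x)\rangle$). $\mathcal A$ may make intermediate measurements and choose its queries, and the interleaving of classical and quantum queries, adaptively. *)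

theory Defs
  imports "HOL-Analysis.Analysis" "HOL-Probability.Probability" "HOL-Library.Z2"
begin

instance bit :: finite
proof
  have "x \<in> {0, 1}" for x :: bit
    by (cases x) simp_all
  then have "(UNIV :: bit set) \<subseteq> {0, 1}"
    by blast
  then show "finite (UNIV :: bit set)"
    by (rule finite_subset) simp
qed

text \<open>
  The set of bit strings of length \<open>n = CARD('n)\<close>. Addition on \<open>bit\<close> is addition modulo 2,
  so \<open>x + k\<close> is the bitwise exclusive or of \<open>x\<close> and \<open>k\<close>.
\<close>

type_synonym 'n bits = "bit ^ 'n"

text \<open>
  Pure states and operators of a quantum memory consisting of a finite-dimensional work space
  (basis indexed by \<open>'w\<close>), a query register and a response register.
\<close>

type_synonym ('n, 'w) state = "complex ^ ('w \<times> 'n bits \<times> 'n bits)"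

type_synonym ('n, 'w) operator =
  "complex ^ ('w \<times> 'n bits \<times> 'n bits) ^ ('w \<times> 'n bits \<times> 'n bits)"

definition dagger :: "complex ^ 'a ^ 'b \<Rightarrow> complex ^ 'b ^ 'a"
  where "dagger M = (\<chi> i j. cnj (M $ j $ i))"

text \<open>
  The unitary of a quantum query to \<open>f\<close>: on basis vectors, \<open>|w, x, y\<rangle>\<close> is mapped to
  \<open>|w, x, y + f x\<rangle>\<close>.
\<close>

definition query_unitary ::
    "('n::finite bits \<Rightarrow> 'n bits) \<Rightarrow> ('n, 'w::finite) operator"
  where "query_unitary f =
    (\<chi> b' b. if b' = (case b of (w, x, y) \<Rightarrow> (w, x, y + f x)) then 1 else 0)"

text \<open>
  An adaptive algorithm is a finite-depth decision tree acting on the quantum memory. The position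
  in the tree is the classical information obtained so far (outcomes of measurements and answers
  to classical queries), and it determines the next operation, including whether the next query is
  classical or quantum. \<open>Measure K c\<close> performs the measurement with operators \<open>K i\<close> and
  continues with \<open>c i\<close> upon outcome \<open>i\<close>. A unitary \<open>U\<close> is the special case in which
  one of the operators is \<open>U\<close> and all others vanish, and a general quantum channel is the special
  case in which the continuation does not depend on the outcome. Before a quantum query, such
  steps can move arbitrary contents of the memory into the query and response registers.
\<close>

datatype ('n::finite, 'w::finite, 'o::finite) algorithm =
    Output bool
  | Measure "'o \<Rightarrow> ('n, 'w) operator" "'o \<Rightarrow> ('n, 'w, 'o) algorithm"
  | Classical_Query "'n bits" "'n bits \<Rightarrow> ('n, 'w, 'o) algorithm"
  | Quantum_Query "('n, 'w, 'o) algorithm"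

primrec well_formed :: "('n::finite, 'w::finite, 'o::finite) algorithm \<Rightarrow> bool" where
  "well_formed (Output b) \<longleftrightarrow> True"
| "well_formed (Measure K c) \<longleftrightarrow>
     (\<Sum>i\<in>UNIV. dagger (K i) ** K i) = mat 1 \<and> (\<forall>i. well_formed (c i))"
| "well_formed (Classical_Query x c) \<longleftrightarrow> (\<forall>y. well_formed (c y))"
| "well_formed (Quantum_Query A) \<longleftrightarrow> well_formed A"

text \<open>The maximal numbers of classical and of quantum queries on any path of the tree.\<close>

primrec classical_queries :: "('n::finite, 'w::finite, 'o::finite) algorithm \<Rightarrow> nat" where
  "classical_queries (Output b) = 0"
| "classical_queries (Measure K c) = Max (range (\<lambda>i. classical_queries (c i)))"
| "classical_queries (Classical_Query x c) = Suc (Max (range (\<lambda>y. classical_queries (c y))))"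
| "classical_queries (Quantum_Query A) = classical_queries A"

primrec quantum_queries :: "('n::finite, 'w::finite, 'o::finite) algorithm \<Rightarrow> nat" where
  "quantum_queries (Output b) = 0"
| "quantum_queries (Measure K c) = Max (range (\<lambda>i. quantum_queries (c i)))"
| "quantum_queries (Classical_Query x c) = Max (range (\<lambda>y. quantum_queries (c y)))"
| "quantum_queries (Quantum_Query A) = Suc (quantum_queries A)"

text \<open>
  The Born rule. This is a genuine distribution if \<open>\<psi>\<close> is a unit vector and the measurement
  operators satisfy the completeness relation in \<open>well_formed\<close>.
\<close>

definition measurement_outcome ::
    "('o::finite \<Rightarrow> ('n::finite, 'w::finite) operator) \<Rightarrow> ('n, 'w) state \<Rightarrow> 'o pmf"
  where "measurement_outcome K \<psi> = embed_pmf (\<lambda>i. (norm (K i *v \<psi>))\<^sup>2)"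

text \<open>
  The output distribution of an algorithm started in the unit vector \<open>\<psi>\<close>, with classical access to
  \<open>O1\<close> and quantum access to \<open>O2\<close>.
\<close>

primrec run ::
    "('n::finite, 'w::finite, 'o::finite) algorithm \<Rightarrow> ('n, 'w) state \<Rightarrow>
     ('n bits \<Rightarrow> 'n bits) \<Rightarrow> ('n bits \<Rightarrow> 'n bits) \<Rightarrow> bool pmf" where
  "run (Output b) \<psi> O1 O2 = return_pmf b"
| "run (Measure K c) \<psi> O1 O2 =
     bind_pmf (measurement_outcome K \<psi>)
       (\<lambda>i. run (c i) ((K i *v \<psi>) /\<^sub>R norm (K i *v \<psi>)) O1 O2)"
| "run (Classical_Query x c) \<psi> O1 O2 = run (c (O1 x)) \<psi> O1 O2"
| "run (Quantum_Query A) \<psi> O1 O2 = run A (query_unitary O2 *v \<psi>) O1 O2"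

definition E :: "'n::finite bits \<Rightarrow> ('n bits \<Rightarrow> 'n bits) \<Rightarrow> 'n bits \<Rightarrow> 'n bits"
  where "E k F x = F (x + k)"

end

theory Submission
  imports Defs
begin

text \<open>
  The run with a random function \<open>R\<close> (the ideal run) is described by its unnormalised state
  \<open>\<psi> F\<close> along a path of the decision tree, as a function of the uniformly random \<open>F\<close>. If \<open>X\<close> is
  the set of classical queries so far, the run with \<open>E k F\<close> (the real run) has an \<open>F\<close> whose values on
  \<open>X + k\<close> are fixed by the answers, and its state is close in mean square to the average of
  \<open>\<psi>\<close> over the values of \<open>F\<close> on \<open>X + k\<close>. A classical query at \<open>x\<close> enlarges the distance by the
  dependence of \<open>\<psi>\<close> on \<open>F (x + k)\<close>. Summed over all points, the squared dependence is at most the number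
  of quantum queries, so with a uniform \<open>k\<close> this costs \<open>sqrt (q\<^sub>F / N)\<close> where \<open>N = 2 ^ n\<close>. A quantum query
  is affected only by its amplitude on \<open>X + k\<close>, which costs \<open>2 * sqrt (q\<^sub>E / N)\<close>. Averaging over \<open>F\<close>
  also loses squared norm, at most \<open>q\<^sub>E * q\<^sub>F / N\<close>. Measurements preserve all these mean squares when summed
  over the outcomes, so the Minkowski and Cauchy-Schwarz inequalities carry the estimate through the tree.
\<close>

section \<open>Averages and mean squares over a finite type\<close>

definition avg :: "('a::finite \<Rightarrow> 'b::real_vector) \<Rightarrow> 'b"
  where "avg f = (\<Sum>x\<in>UNIV. f x) /\<^sub>R real CARD('a)"

definition msq :: "('a::finite \<Rightarrow> 'b::real_inner) \<Rightarrow> real"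
  where "msq f = avg (\<lambda>x. (norm (f x))\<^sup>2)"

lemma avg_const [simp]: "avg (\<lambda>x::'a::finite. c) = c"
  by (simp add: avg_def sum_constant_scaleR)

lemma avg_diff: "avg (\<lambda>x. f x - g x) = avg f - avg g"
  by (simp add: avg_def sum_subtractf scaleR_diff_right)

lemma avg_add: "avg (\<lambda>x. f x + g x) = avg f + avg g"
  by (simp add: avg_def sum.distrib scaleR_add_right)

lemma avg_linear: "linear h \<Longrightarrow> h (avg f) = avg (\<lambda>x. h (f x))"
  by (simp add: avg_def linear_sum linear_cmul)

lemma avg_sum: "avg (\<lambda>x. \<Sum>i\<in>I. f i x) = (\<Sum>i\<in>I. avg (f i))"
  unfolding avg_def by (subst sum.swap) (simp add: scaleR_sum_right)

lemma avg_mono: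
  fixes f g :: "'a::finite \<Rightarrow> real"
  shows "(\<And>x. f x \<le> g x) \<Longrightarrow> avg f \<le> avg g"
  by (simp add: avg_def sum_mono mult_left_mono)

lemma avg_pair: "avg f = avg (\<lambda>y. avg (\<lambda>x. f (x, y)))"
proof -
  have "(\<Sum>p\<in>UNIV. f p) = (\<Sum>y\<in>UNIV. \<Sum>x\<in>UNIV. f (x, y))"
    by (subst sum.swap) (simp add: sum.cartesian_product flip: UNIV_Times_UNIV)
  then show ?thesis
    by (simp add: avg_def scaleR_sum_right mult.commute)
qed

lemma avg_swap: "avg (\<lambda>x. avg (f x)) = avg (\<lambda>y. avg (\<lambda>x. f x y))"
  unfolding avg_def by (simp add: scaleR_sum_right mult.commute) (rule sum.swap)

lemma avg_bij: "bij h \<Longrightarrow> avg (\<lambda>x. f (h x)) = avg f"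
  unfolding avg_def by (simp add: sum.reindex_bij_betw bij_betw_same_card)

lemma avg_inner_right: "avg (\<lambda>x. c \<bullet> f x) = c \<bullet> avg f"
  by (simp add: avg_def inner_sum_right)

lemma abs_avg_le: "\<bar>avg f\<bar> \<le> avg (\<lambda>x. \<bar>f x\<bar>)"
  for f :: "'a::finite \<Rightarrow> real"
  by (simp add: avg_def abs_mult sum_abs mult_left_mono)

lemma msq_nonneg [simp]: "0 \<le> msq f"
  by (simp add: msq_def avg_def sum_nonneg)

lemma sqrt_msq: "sqrt (msq f) = L2_set (\<lambda>x. norm (f x)) UNIV / sqrt (real CARD('a))"
  for f :: "'a::finite \<Rightarrow> 'b::real_inner"
  by (simp add: msq_def avg_def L2_set_def real_sqrt_mult real_sqrt_inverse divide_inverse mult.commute)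

lemma sqrt_msq_triangle: "sqrt (msq (\<lambda>x. f x + g x)) \<le> sqrt (msq f) + sqrt (msq g)"
proof -
  have "L2_set (\<lambda>x. norm (f x + g x)) UNIV \<le> L2_set (\<lambda>x. norm (f x) + norm (g x)) UNIV"
    by (intro L2_set_mono) (auto intro: norm_triangle_ineq)
  also have "\<dots> \<le> L2_set (\<lambda>x. norm (f x)) UNIV + L2_set (\<lambda>x. norm (g x)) UNIV"
    by (rule L2_set_triangle_ineq)
  finally show ?thesis
    unfolding sqrt_msq add_divide_distrib[symmetric] by (intro divide_right_mono) auto
qed

text \<open>The variance is nonnegative: it equals \<open>msq f\<close> minus the squared norm of
  \<open>avg f\<close>.\<close>

lemma norm_avg_le: "(norm (avg f))\<^sup>2 \<le> msq f"
proof -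
  have "0 \<le> avg (\<lambda>x. (norm (f x - avg f))\<^sup>2)"
    by (simp add: avg_def sum_nonneg)
  also have "(\<lambda>x. (norm (f x - avg f))\<^sup>2) = (\<lambda>x. (norm (f x))\<^sup>2 + (norm (avg f))\<^sup>2 - 2 * (avg f \<bullet> f x))"
    by (auto simp: power2_norm_eq_inner inner_diff_left inner_diff_right inner_commute)
  also have "avg \<dots> = msq f + (norm (avg f))\<^sup>2 - avg (\<lambda>x. (2 *\<^sub>R avg f) \<bullet> f x)"
    by (simp add: avg_diff avg_add msq_def)
  also have "\<dots> = msq f - (norm (avg f))\<^sup>2"
    unfolding avg_inner_right by (simp add: power2_norm_eq_inner)
  finally show ?thesis by simp
qed

section \<open>Resampling of function values, and influence\<close>

text \<open>The conditional expectation of \<open>\<psi>\<close> given the values of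
  \<open>F\<close> outside \<open>S\<close>.\<close>

definition resample :: "'a set \<Rightarrow> (('a::finite \<Rightarrow> 'b::finite) \<Rightarrow> 'c::real_vector) \<Rightarrow> ('a \<Rightarrow> 'b) \<Rightarrow> 'c"
  where "resample S \<psi> F = avg (\<lambda>G. \<psi> (override_on F G S))"

text \<open>Exchanging the values of \<open>F\<close> and \<open>G\<close> on \<open>S\<close> is an
  involution on pairs, so the spliced function is again uniform.\<close>

lemma avg_override_on: "avg (\<lambda>F. avg (\<lambda>G. h (override_on F G S))) = avg h"
proof -
  let ?i = "\<lambda>p. (override_on (fst p) (snd p) S, override_on (snd p) (fst p) S)"
  have "bij ?i"
    by (rule involuntory_imp_bij) (auto simp: override_on_def)
  from avg_bij[OF this, of "h \<circ> fst"] show ?thesis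
    by (subst avg_swap) (simp add: avg_pair)
qed

text \<open>The map from \<open>(F, y)\<close> to \<open>(F(s := y), F s)\<close> is an involution.
  Hence the value at \<open>s\<close> can be drawn separately, which turns the answer to a classical
  query into a branch.\<close>

lemma avg_fun_upd: "avg (\<lambda>F. h (F s) F) = avg (\<lambda>y. avg (\<lambda>F. h y (F(s := y))))"
proof -
  let ?i = "\<lambda>p. ((fst p)(s := snd p), fst p s)"
  let ?h = "\<lambda>p. h (fst p s) (fst p)"
  have "bij ?i"
    by (rule involuntory_imp_bij) auto
  from avg_bij[OF this, of ?h] show ?thesis
    by (simp add: avg_pair)
qed

lemma resample_cong: "(\<And>z. z \<notin> S \<Longrightarrow> F z = F' z) \<Longrightarrow> resample S \<psi> F = resample S \<psi> F'"
  unfolding resample_def by (intro arg_cong[where f = avg] ext arg_cong[where f = \<psi>]) (simp add: override_on_def)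

lemma resample_resample: "resample S (resample T \<psi>) F = resample (S \<union> T) \<psi> F"
proof -
  have "override_on (override_on F G S) H T = override_on F (override_on G H T) (S \<union> T)" for G H
    by (auto simp: override_on_def)
  then show ?thesis
    using avg_override_on[of "\<lambda>G. \<psi> (override_on F G (S \<union> T))" T] by (simp add: resample_def)
qed

lemma resample_diff: "resample S (\<lambda>F. \<psi> F - \<phi> F) F = resample S \<psi> F - resample S \<phi> F"
  by (simp add: resample_def avg_diff)

lemma resample_linear: "linear h \<Longrightarrow> resample S (\<lambda>F. h (\<psi> F)) F = h (resample S \<psi> F)"
  by (simp add: resample_def avg_linear)

lemma resample_empty [simp]: "resample {} \<psi> = \<psi>"
  by (simp add: resample_def fun_eq_iff)

lemma msq_resample_le: "msq (resample S \<psi>) \<le> msq \<psi>"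
proof -
  have "msq (resample S \<psi>) \<le> avg (\<lambda>F. avg (\<lambda>G. (norm (\<psi> (override_on F G S)))\<^sup>2))"
    unfolding msq_def resample_def
    by (intro avg_mono) (rule norm_avg_le[unfolded msq_def])
  then show ?thesis
    by (simp add: avg_override_on[where h = "\<lambda>F. (norm (\<psi> F))\<^sup>2"] msq_def)
qed

text \<open>\<open>resample S\<close> is an orthogonal projection in mean square. The cross term is
  \<open>msq (resample S \<psi>)\<close>, because the resampled function is constant in the values
  on \<open>S\<close> and leaves the inner average.\<close>

lemma msq_resample_pythagoras:
  "msq \<psi> = msq (resample S \<psi>) + msq (\<lambda>F. \<psi> F - resample S \<psi> F)"
proof -
  let ?P = "resample S \<psi>"
  have inv: "?P (override_on F G S) = ?P F" for F G
    by (rule resample_cong) simp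
  have "avg (\<lambda>F. \<psi> F \<bullet> ?P F) = avg (\<lambda>F. avg (\<lambda>G. ?P F \<bullet> \<psi> (override_on F G S)))"
    by (subst avg_override_on[symmetric, of _ S]) (simp add: inv inner_commute)
  also have "\<dots> = msq ?P"
    by (simp add: avg_inner_right resample_def[symmetric] msq_def power2_norm_eq_inner)
  finally have *: "avg (\<lambda>F. \<psi> F \<bullet> ?P F) = msq ?P" .
  have "msq (\<lambda>F. \<psi> F - ?P F)
      = avg (\<lambda>F. (norm (\<psi> F))\<^sup>2 + (norm (?P F))\<^sup>2 - (\<psi> F \<bullet> ?P F + \<psi> F \<bullet> ?P F))"
    unfolding msq_def
    by (intro arg_cong[where f = avg] ext)
       (simp add: power2_norm_eq_inner inner_diff_left inner_diff_right inner_commute)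
  also have "\<dots> = msq \<psi> - msq ?P"
    unfolding avg_diff avg_add * by (simp add: msq_def)
  finally show ?thesis by simp
qed

lemma msq_diff_resample_le: "msq (\<lambda>F. \<psi> F - resample S \<psi> F) \<le> msq \<psi>"
  using msq_resample_pythagoras[of \<psi> S] by simp

lemma msq_resample_insert_le:
  "msq (\<lambda>F. resample S \<psi> F - resample (insert s S) \<psi> F) \<le> msq (\<lambda>F. \<psi> F - resample {s} \<psi> F)"
proof -
  have "resample S \<psi> F - resample (insert s S) \<psi> F = resample S (\<lambda>F. \<psi> F - resample {s} \<psi> F) F" for F
    unfolding resample_diff resample_resample by simp
  then show ?thesis
    by (simp add: msq_resample_le)
qed

text \<open>The total influence: the summand at \<open>s\<close> is the mean conditional variance of
  \<open>\<psi>\<close> given all values of \<open>F\<close> except that at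
  \<open>s\<close>.\<close>

definition influence :: "(('a::finite \<Rightarrow> 'b::finite) \<Rightarrow> 'c::real_inner) \<Rightarrow> real"
  where "influence \<psi> = (\<Sum>s\<in>UNIV. msq (\<lambda>F. \<psi> F - resample {s} \<psi> F))"

lemma influence_nonneg [simp]: "0 \<le> influence \<psi>"
  by (simp add: influence_def sum_nonneg)

text \<open>An Efron-Stein inequality. Points are resampled one at a time; by Pythagoras each loses
  the squared distance moved, and resampling other points first can only shorten that
  distance.\<close>

lemma msq_resample_loss:
  "msq \<psi> - msq (resample S \<psi>) \<le> (\<Sum>s\<in>S. msq (\<lambda>F. \<psi> F - resample {s} \<psi> F))"
proof -
  have "finite S" by simp
  then show ?thesis
  proof (induction S)
    case empty
    then show ?case by simp
  next
    case (insert s S)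
    have r: "resample {s} (resample S \<psi>) = resample (insert s S) \<psi>"
      by (simp add: fun_eq_iff resample_resample)
    have "msq (resample S \<psi>) - msq (resample (insert s S) \<psi>)
        \<le> msq (\<lambda>F. \<psi> F - resample {s} \<psi> F)"
      using msq_resample_pythagoras[of "resample S \<psi>" "{s}"] msq_resample_insert_le[of S \<psi> s]
      unfolding r by simp
    with insert show ?case by simp
  qed
qed

section \<open>Bit strings and translates by a uniform key\<close>

lemma card_bit: "CARD(bit) = 2"
proof -
  have "(UNIV :: bit set) = {0, 1}"
    using bit.exhaust by auto
  then have "CARD(bit) = card {0, 1 :: bit}"
    by (rule arg_cong)
  then show ?thesis by simp
qed

lemma bits_add_self [simp]: "k + k = 0" for k :: "bit ^ 'n::finite"
proof -
  have "b + b = 0" for b :: bit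
    by (cases b) simp_all
  then show ?thesis
    by (simp add: vec_eq_iff)
qed

lemma bits_add_cancel [simp]: "x + k + k = x" for x k :: "bit ^ 'n::finite"
  by (simp add: add.assoc)

lemma sum_add_bits: "(\<Sum>y\<in>UNIV. h (y + k)) = (\<Sum>y\<in>UNIV. h y)" for k :: "bit ^ 'n::finite"
  by (rule sum.reindex_bij_betw[OF bij_plus_right])

lemma mem_translate_iff: "z \<in> (\<lambda>x. x + k) ` X \<longleftrightarrow> z + k \<in> X" for k :: "bit ^ 'n::finite"
  by (auto intro: image_eqI[where x = "z + k"])

text \<open>Each \<open>x + k\<close> is uniform when \<open>k\<close> is, so linearity of
  expectation suffices.\<close>

lemma avg_sum_translate:
  fixes f :: "bit ^ 'n::finite \<Rightarrow> real"
  shows "avg (\<lambda>k. \<Sum>s\<in>(\<lambda>x. x + k) ` X. f s) = real (card X) * avg f"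
proof -
  have "(\<Sum>s\<in>(\<lambda>x. x + k) ` X. f s) = (\<Sum>x\<in>X. f (x + k))" for k
    by (subst sum.reindex) (auto simp: inj_on_def)
  moreover have "avg (\<lambda>k. f (x + k)) = avg f" for x
    using avg_bij[OF bij_plus_right[of x], of f] by (simp add: add.commute)
  ultimately show ?thesis
    by (simp add: avg_sum)
qed

section \<open>Queries and measurements on the quantum memory\<close>

lemma norm_vec_sq: "(norm \<phi>)\<^sup>2 = (\<Sum>i\<in>UNIV. (norm (\<phi> $ i))\<^sup>2)"
  by (simp add: norm_vec_def L2_set_def sum_nonneg)

lemma sum_UNIV_triple:
  "(\<Sum>i\<in>UNIV. f i) = (\<Sum>w\<in>UNIV. \<Sum>x\<in>UNIV. \<Sum>y\<in>UNIV. f (w, x, y))"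
  by (simp add: sum.cartesian_product flip: UNIV_Times_UNIV)

lemma msq_vec: "msq \<psi> = (\<Sum>i\<in>UNIV. msq (\<lambda>F. \<psi> F $ i))"
  unfolding msq_def norm_vec_sq by (rule avg_sum)

lemma resample_nth: "resample S \<psi> F $ i = resample S (\<lambda>F. \<psi> F $ i) F"
  by (simp add: resample_def avg_def)

lemma linear_matrix_vector_mult: "linear ((*v) K)" for K :: "complex ^ 'a::finite ^ 'b::finite"
  by (rule linearI)
     (simp_all add: vec_eq_iff matrix_vector_mult_def sum.distrib ring_distribs scaleR_sum_right)

lemma query_unitary_nth:
  "(query_unitary f *v \<phi>) $ (w, x, y) = \<phi> $ (w, x, y + f x)"
proof -
  have "(w, x, y) = (case j of (w, x, y) \<Rightarrow> (w, x, y + f x)) \<longleftrightarrow> j = (w, x, y + f x)" for j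
    by (cases j) auto
  then show ?thesis
    by (simp add: query_unitary_def matrix_vector_mult_def if_distrib[where f = "\<lambda>c. c * _"] sum.delta
        cong: if_cong)
qed

lemma norm_query_unitary [simp]: "norm (query_unitary f *v \<phi>) = norm \<phi>"
proof -
  have "(norm (query_unitary f *v \<phi>))\<^sup>2 = (norm \<phi>)\<^sup>2"
    unfolding norm_vec_sq sum_UNIV_triple query_unitary_nth
    by (simp add: sum_add_bits[where h = "\<lambda>y. (norm (\<phi> $ (_, _, y)))\<^sup>2"])
  then show ?thesis by simp
qed

definition query_weight :: "('n::finite, 'w::finite) state \<Rightarrow> 'n bits \<Rightarrow> real"
  where "query_weight \<phi> x = (\<Sum>w\<in>UNIV. \<Sum>y\<in>UNIV. (norm (\<phi> $ (w, x, y)))\<^sup>2)"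

lemma sum_query_weight: "(\<Sum>x\<in>UNIV. query_weight \<phi> x) = (norm \<phi>)\<^sup>2"
  unfolding query_weight_def norm_vec_sq sum_UNIV_triple by (rule sum.swap)

text \<open>Components with query \<open>x\<close> outside \<open>S\<close> cancel. On the others a
  squared difference is at most twice the sum of the squares, and both shifts of the response
  register preserve the weight, whence the 4.\<close>

lemma norm_query_unitary_diff:
  assumes "\<And>x. x \<notin> S \<Longrightarrow> f x = g x"
  shows "(norm (query_unitary f *v \<phi> - query_unitary g *v \<phi>))\<^sup>2 \<le> 4 * (\<Sum>x\<in>S. query_weight \<phi> x)"
proof -
  have sq: "(norm (a - b))\<^sup>2 \<le> 2 * (norm a)\<^sup>2 + 2 * (norm b)\<^sup>2" for a b :: complex
  proof -
    have "(norm (a - b))\<^sup>2 \<le> (norm a + norm b)\<^sup>2"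
      by (intro power_mono norm_triangle_ineq4) auto
    also have "\<dots> \<le> 2 * (norm a)\<^sup>2 + 2 * (norm b)\<^sup>2"
      using sum_squares_bound[of "norm a" "norm b"] by (simp add: power2_sum)
    finally show ?thesis .
  qed
  have "(norm (query_unitary f *v \<phi> - query_unitary g *v \<phi>))\<^sup>2
      = (\<Sum>x\<in>UNIV. \<Sum>w\<in>UNIV. \<Sum>y\<in>UNIV. (norm (\<phi> $ (w, x, y + f x) - \<phi> $ (w, x, y + g x)))\<^sup>2)"
    unfolding norm_vec_sq sum_UNIV_triple
    by (subst sum.swap) (simp add: query_unitary_nth)
  also have "\<dots> = (\<Sum>x\<in>S. \<Sum>w\<in>UNIV. \<Sum>y\<in>UNIV. (norm (\<phi> $ (w, x, y + f x) - \<phi> $ (w, x, y + g x)))\<^sup>2)"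
    by (rule sum.mono_neutral_right) (auto simp: assms)
  also have "\<dots> \<le> (\<Sum>x\<in>S. \<Sum>w\<in>UNIV. \<Sum>y\<in>UNIV.
      2 * (norm (\<phi> $ (w, x, y + f x)))\<^sup>2 + 2 * (norm (\<phi> $ (w, x, y + g x)))\<^sup>2)"
    by (intro sum_mono sq)
  also have "\<dots> = 4 * (\<Sum>x\<in>S. query_weight \<phi> x)"
    by (simp add: sum.distrib sum_distrib_left[symmetric] query_weight_def
        sum_add_bits[where h = "\<lambda>y. (norm (\<phi> $ (_, _, y)))\<^sup>2"])
  finally show ?thesis .
qed

text \<open>A query to \<open>F\<close> at \<open>x\<close> can only create dependence on the value \<open>F x\<close>, so in total the influence
  grows by at most the squared norm.\<close>

lemma influence_query_unitary:
  fixes \<psi> :: "('n::finite bits \<Rightarrow> 'n bits) \<Rightarrow> ('n, 'w::finite) state"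
  shows "influence (\<lambda>F. query_unitary F *v \<psi> F) \<le> influence \<psi> + msq \<psi>"
proof -
  let ?r = "\<lambda>s h. msq (\<lambda>F. h F - resample {s} h F)"
  have shift: "(\<Sum>y\<in>UNIV. msq (\<lambda>F. g F (y + F x))) = (\<Sum>y\<in>UNIV. msq (\<lambda>F. g F y))"
    for g :: "('n bits \<Rightarrow> 'n bits) \<Rightarrow> 'n bits \<Rightarrow> complex" and x
    unfolding msq_def avg_sum[symmetric] by (simp add: sum_add_bits[where h = "\<lambda>y. (norm (g _ y))\<^sup>2"])
  have step: "(\<Sum>y\<in>UNIV. ?r s (\<lambda>F. \<psi> F $ (w, x, y + F x)))
      \<le> (\<Sum>y\<in>UNIV. ?r s (\<lambda>F. \<psi> F $ (w, x, y))) + (if s = x then \<Sum>y\<in>UNIV. msq (\<lambda>F. \<psi> F $ (w, x, y)) else 0)"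
    for s w x
  proof (cases "s = x")
    case True
    have "(\<Sum>y\<in>UNIV. ?r s (\<lambda>F. \<psi> F $ (w, x, y + F x))) \<le> (\<Sum>y\<in>UNIV. msq (\<lambda>F. \<psi> F $ (w, x, y + F x)))"
      by (intro sum_mono msq_diff_resample_le)
    also have "\<dots> = (\<Sum>y\<in>UNIV. msq (\<lambda>F. \<psi> F $ (w, x, y)))"
      by (rule shift)
    finally show ?thesis
      using True by (simp add: sum_nonneg add_increasing)
  next
    \<comment> \<open>Resampling at \<open>s\<close> leaves \<open>F x\<close> alone, so the shift
      by \<open>F x\<close> moves outside the resampling.\<close>
    case False
    then have "resample {s} (\<lambda>F. \<psi> F $ (w, x, y + F x)) F = resample {s} (\<lambda>G. \<psi> G $ (w, x, y + F x)) F"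
      for y F
      by (simp add: resample_def override_on_def)
    then have "(\<Sum>y\<in>UNIV. ?r s (\<lambda>F. \<psi> F $ (w, x, y + F x))) = (\<Sum>y\<in>UNIV. ?r s (\<lambda>F. \<psi> F $ (w, x, y)))"
      using shift[of "\<lambda>F y. \<psi> F $ (w, x, y) - resample {s} (\<lambda>F. \<psi> F $ (w, x, y)) F" x] by (simp only:)
    with False show ?thesis by simp
  qed
  have "influence (\<lambda>F. query_unitary F *v \<psi> F)
      = (\<Sum>s\<in>UNIV. \<Sum>w\<in>UNIV. \<Sum>x\<in>UNIV. \<Sum>y\<in>UNIV. ?r s (\<lambda>F. \<psi> F $ (w, x, y + F x)))"
    by (simp add: influence_def msq_vec resample_nth sum_UNIV_triple query_unitary_nth)
  also have "\<dots> \<le> (\<Sum>s\<in>UNIV. \<Sum>w\<in>UNIV. \<Sum>x\<in>UNIV. (\<Sum>y\<in>UNIV. ?r s (\<lambda>F. \<psi> F $ (w, x, y)))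
      + (if s = x then \<Sum>y\<in>UNIV. msq (\<lambda>F. \<psi> F $ (w, x, y)) else 0))"
    by (intro sum_mono step)
  \<comment> \<open>Each \<open>x\<close> is charged only at \<open>s = x\<close>, so the extra
    terms add up to one full squared norm.\<close>
  also have "\<dots> = influence \<psi> + (\<Sum>s\<in>UNIV. \<Sum>w\<in>UNIV. \<Sum>y\<in>UNIV. msq (\<lambda>F. \<psi> F $ (w, s, y)))"
    by (simp add: sum.distrib influence_def msq_vec resample_nth sum_UNIV_triple)
  also have "\<dots> = influence \<psi> + msq \<psi>"
    by (subst sum.swap) (simp add: msq_vec sum_UNIV_triple)
  finally show ?thesis .
qed

lemma sum_norm_measurement:
  fixes K :: "'o::finite \<Rightarrow> complex ^ 'a::finite ^ 'a"
  assumes "(\<Sum>i\<in>UNIV. dagger (K i) ** K i) = mat 1"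
  shows "(\<Sum>i\<in>UNIV. (norm (K i *v \<phi>))\<^sup>2) = (norm \<phi>)\<^sup>2"
proof -
  have norm_eq: "complex_of_real ((norm \<xi>)\<^sup>2) = (\<Sum>j\<in>UNIV. cnj (\<xi> $ j) * \<xi> $ j)" for \<xi> :: "complex ^ 'a"
    by (simp add: norm_vec_sq complex_norm_square mult.commute del: of_real_power)
  have adj: "(\<Sum>j\<in>UNIV. cnj ((M *v \<phi>) $ j) * (M *v \<phi>) $ j)
      = (\<Sum>a\<in>UNIV. \<Sum>b\<in>UNIV. cnj (\<phi> $ a) * \<phi> $ b * (dagger M ** M) $ a $ b)" for M :: "complex ^ 'a ^ 'a"
  proof -
    have "(\<Sum>j\<in>UNIV. cnj ((M *v \<phi>) $ j) * (M *v \<phi>) $ j)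
        = (\<Sum>j\<in>UNIV. \<Sum>a\<in>UNIV. \<Sum>b\<in>UNIV. cnj (\<phi> $ a) * \<phi> $ b * (cnj (M $ j $ a) * M $ j $ b))"
      by (simp add: matrix_vector_mult_def sum_product mult_ac) (rule sum.cong[OF refl], rule sum.swap)
    also have "\<dots> = (\<Sum>a\<in>UNIV. \<Sum>b\<in>UNIV. \<Sum>j\<in>UNIV. cnj (\<phi> $ a) * \<phi> $ b * (cnj (M $ j $ a) * M $ j $ b))"
      by (subst sum.swap) (rule sum.cong[OF refl], rule sum.swap)
    finally show ?thesis
      by (simp add: matrix_matrix_mult_def dagger_def sum_distrib_left)
  qed
  have "complex_of_real (\<Sum>i\<in>UNIV. (norm (K i *v \<phi>))\<^sup>2)
      = (\<Sum>i\<in>UNIV. \<Sum>a\<in>UNIV. \<Sum>b\<in>UNIV. cnj (\<phi> $ a) * \<phi> $ b * (dagger (K i) ** K i) $ a $ b)"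
    by (simp only: of_real_sum norm_eq adj)
  also have "\<dots> = (\<Sum>a\<in>UNIV. \<Sum>b\<in>UNIV. \<Sum>i\<in>UNIV. cnj (\<phi> $ a) * \<phi> $ b * (dagger (K i) ** K i) $ a $ b)"
    by (subst sum.swap) (rule sum.cong[OF refl], rule sum.swap)
  also have "\<dots> = (\<Sum>a\<in>UNIV. \<Sum>b\<in>UNIV. cnj (\<phi> $ a) * \<phi> $ b * (mat 1 :: complex ^ 'a ^ 'a) $ a $ b)"
    by (simp add: sum_distrib_left[symmetric] assms[symmetric] sum_component)
  also have "\<dots> = complex_of_real ((norm \<phi>)\<^sup>2)"
    unfolding norm_eq by (simp add: mat_def if_distrib[where f = "\<lambda>c. _ * c"] cong: if_cong)
  finally show ?thesis
    by (simp only: of_real_eq_iff)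
qed

lemma sum_msq_measurement:
  fixes K :: "'o::finite \<Rightarrow> complex ^ 'a::finite ^ 'a"
  assumes "(\<Sum>i\<in>UNIV. dagger (K i) ** K i) = mat 1"
  shows "(\<Sum>i\<in>UNIV. msq (\<lambda>F. K i *v \<psi> F)) = msq \<psi>"
  unfolding msq_def avg_sum[symmetric] sum_norm_measurement[OF assms] ..

lemma sum_influence_measurement:
  fixes K :: "'o::finite \<Rightarrow> complex ^ 'a::finite ^ 'a"
  assumes "(\<Sum>i\<in>UNIV. dagger (K i) ** K i) = mat 1"
  shows "(\<Sum>i\<in>UNIV. influence (\<lambda>F. K i *v \<psi> F)) = influence \<psi>"
  unfolding influence_def
  by (subst sum.swap)
     (simp add: resample_linear linear_matrix_vector_mult sum_msq_measurement[OF assms]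
       flip: matrix_vector_mult_diff_distrib)

section \<open>Acceptance bias of an algorithm\<close>

text \<open>\<open>bias A \<phi> O1 O2\<close> is the probability of output \<open>True\<close> minus that of output \<open>False\<close>, extended to
  unnormalised states by homogeneity.\<close>

primrec bias ::
    "('n::finite, 'w::finite, 'o::finite) algorithm \<Rightarrow> ('n, 'w) state \<Rightarrow>
     ('n bits \<Rightarrow> 'n bits) \<Rightarrow> ('n bits \<Rightarrow> 'n bits) \<Rightarrow> real" where
  "bias (Output b) \<phi> O1 O2 = (if b then 1 else - 1) * (norm \<phi>)\<^sup>2"
| "bias (Measure K c) \<phi> O1 O2 = (\<Sum>i\<in>UNIV. bias (c i) (K i *v \<phi>) O1 O2)"
| "bias (Classical_Query x c) \<phi> O1 O2 = bias (c (O1 x)) \<phi> O1 O2"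
| "bias (Quantum_Query A) \<phi> O1 O2 = bias A (query_unitary O2 *v \<phi>) O1 O2"

lemma bias_scaleR: "bias A (r *\<^sub>R \<phi>) O1 O2 = r\<^sup>2 * bias A \<phi> O1 O2"
  by (induction A arbitrary: \<phi>)
     (simp_all add: linear_cmul[OF linear_matrix_vector_mult] power_mult_distrib sum_distrib_left)

text \<open>The unnormalised branch state carries its probability as squared norm, and homogeneity
  of \<open>bias\<close> compensates the renormalisation in \<open>run\<close>.\<close>

lemma bias_eq_run:
  assumes "well_formed A" "norm \<phi> = 1"
  shows "bias A \<phi> O1 O2 = 2 * pmf (run A \<phi> O1 O2) True - 1"
  using assms
proof (induction A arbitrary: \<phi>)
  case (Measure K c)
  let ?\<phi> = "\<lambda>i. K i *v \<phi>"
  have sum1: "(\<Sum>i\<in>UNIV. (norm (?\<phi> i))\<^sup>2) = 1"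
    using sum_norm_measurement[of K \<phi>] Measure.prems by simp
  have pmf: "pmf (measurement_outcome K \<phi>) i = (norm (?\<phi> i))\<^sup>2" for i
    unfolding measurement_outcome_def using sum1
    by (intro pmf_embed_pmf) (auto simp: nn_integral_count_space_finite sum_ennreal)
  have "bias (c i) (?\<phi> i) O1 O2
      = (norm (?\<phi> i))\<^sup>2 * (2 * pmf (run (c i) (?\<phi> i /\<^sub>R norm (?\<phi> i)) O1 O2) True - 1)" for i
  proof (cases "?\<phi> i = 0")
    \<comment> \<open>For an outcome of probability 0 the renormalised state is no unit vector, so
      the induction hypothesis does not apply; scaling by 0 shows that the branch has bias
      0.\<close>
    case True
    then show ?thesis
      using bias_scaleR[of "c i" 0 0 O1 O2] by simp
  next
    case False
    then have "bias (c i) (?\<phi> i /\<^sub>R norm (?\<phi> i)) O1 O2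
        = 2 * pmf (run (c i) (?\<phi> i /\<^sub>R norm (?\<phi> i)) O1 O2) True - 1"
      using Measure.prems by (intro Measure.IH) auto
    moreover have "bias (c i) (?\<phi> i) O1 O2
        = (norm (?\<phi> i))\<^sup>2 * bias (c i) (?\<phi> i /\<^sub>R norm (?\<phi> i)) O1 O2"
      using False by (subst bias_scaleR[symmetric]) simp
    ultimately show ?thesis by simp
  qed
  moreover have "pmf (run (Measure K c) \<phi> O1 O2) True
      = (\<Sum>i\<in>UNIV. (norm (?\<phi> i))\<^sup>2 * pmf (run (c i) (?\<phi> i /\<^sub>R norm (?\<phi> i)) O1 O2) True)"
    by (simp add: pmf_bind integral_measure_pmf_real[of UNIV] pmf mult.commute)
  ultimately show ?case
    using sum1 by (simp add: right_diff_distrib sum_subtractf sum_distrib_left mult_ac)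
qed auto

lemma pmf_bind_pmf_of_set_UNIV:
  "pmf (bind_pmf (pmf_of_set UNIV) f) x = avg (\<lambda>y. pmf (f y) x)" for f :: "'a::finite \<Rightarrow> 'b pmf"
  by (simp add: pmf_bind integral_pmf_of_set avg_def divide_inverse mult.commute)

section \<open>The error bound as a function of mean squares\<close>

text \<open>Here \<open>N\<close> is the number of keys, \<open>m\<close> the number of reprogrammed points, and \<open>c\<close> and \<open>q\<close> bound
  the remaining classical and quantum queries; \<open>e\<close>, \<open>d\<close>, \<open>a\<close> and \<open>v\<close> stand for the squared distance of the
  real state from the resampled ideal state, the influence of the ideal state, and the squared norms of the
  real and of the ideal state.\<close>

definition gap :: "real \<Rightarrow> real \<Rightarrow> real \<Rightarrow> real \<Rightarrow> real \<Rightarrow> real \<Rightarrow> real \<Rightarrow> real \<Rightarrow> real"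
  where "gap N m c q e d a v =
    (sqrt e + c * sqrt ((d + q * v) / N) + 2 * q * sqrt ((m + c) / N) * sqrt v) * (sqrt a + sqrt v)
    + (m + c) * ((d + q * v) / N)"

text \<open>What is needed at a leaf: the distance times the sum of the norms covers a difference of
  squared norms, and \<open>m * (d / N)\<close> the squared norm lost by resampling.\<close>

lemma gap_ge:
  assumes "0 < N" "0 \<le> m" "0 \<le> c" "0 \<le> q" "0 \<le> e" "0 \<le> d" "0 \<le> a" "0 \<le> v"
  shows "sqrt e * (sqrt a + sqrt v) + m * (d / N) \<le> gap N m c q e d a v"
proof -
  have "m * (d / N) \<le> (m + c) * ((d + q * v) / N)"
    using assms by (intro mult_mono divide_right_mono) auto
  moreover have "sqrt e * (sqrt a + sqrt v) \<le>
      (sqrt e + c * sqrt ((d + q * v) / N) + 2 * q * sqrt ((m + c) / N) * sqrt v) * (sqrt a + sqrt v)"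
    using assms by (intro mult_right_mono) auto
  ultimately show ?thesis
    by (simp add: gap_def)
qed

text \<open>Superadditivity carries the bound through a measurement: Minkowski for each sum of
  square roots, Cauchy-Schwarz for their product; the last summand is linear.\<close>

lemma sum_gap_le:
  assumes "finite I" "0 < N" "0 \<le> m" "0 \<le> c" "0 \<le> q"
    and nonneg: "\<And>i. i \<in> I \<Longrightarrow> 0 \<le> e i" "\<And>i. i \<in> I \<Longrightarrow> 0 \<le> d i"
      "\<And>i. i \<in> I \<Longrightarrow> 0 \<le> a i" "\<And>i. i \<in> I \<Longrightarrow> 0 \<le> v i"
  shows "(\<Sum>i\<in>I. gap N m c q (e i) (d i) (a i) (v i)) \<le> gap N m c q (sum e I) (sum d I) (sum a I) (sum v I)"
proof -
  let ?u = "\<lambda>i. (d i + q * v i) / N" and ?s = "2 * q * sqrt ((m + c) / N)"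
  let ?f = "\<lambda>i. sqrt (e i) + c * sqrt (?u i) + ?s * sqrt (v i)" and ?g = "\<lambda>i. sqrt (a i) + sqrt (v i)"
  have L2: "L2_set (\<lambda>i. sqrt (h i)) I = sqrt (sum h I)" if "\<And>i. i \<in> I \<Longrightarrow> 0 \<le> h i" for h
    using that by (simp add: L2_set_def)
  have u: "0 \<le> ?u i" if "i \<in> I" for i
    using that assms by auto
  have sum_u: "sum ?u I = (sum d I + q * sum v I) / N"
    by (simp add: sum_divide_distrib[symmetric] sum.distrib sum_distrib_left)
  have "L2_set ?f I \<le> L2_set (\<lambda>i. sqrt (e i)) I + L2_set (\<lambda>i. c * sqrt (?u i)) I + L2_set (\<lambda>i. ?s * sqrt (v i)) I"
    by (intro order_trans[OF L2_set_triangle_ineq] add_right_mono L2_set_triangle_ineq)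
  also have "\<dots> = sqrt (sum e I) + c * sqrt (sum ?u I) + ?s * sqrt (sum v I)"
    using assms u by (simp add: L2 flip: L2_set_right_distrib)
  finally have f: "L2_set ?f I \<le> sqrt (sum e I) + c * sqrt (sum ?u I) + ?s * sqrt (sum v I)" .
  have "L2_set ?g I \<le> L2_set (\<lambda>i. sqrt (a i)) I + L2_set (\<lambda>i. sqrt (v i)) I"
    by (rule L2_set_triangle_ineq)
  then have g: "L2_set ?g I \<le> sqrt (sum a I) + sqrt (sum v I)"
    by (simp add: L2 nonneg)
  have "(\<Sum>i\<in>I. ?f i * ?g i) \<le> (\<Sum>i\<in>I. \<bar>?f i\<bar> * \<bar>?g i\<bar>)"
    by (intro sum_mono) (simp flip: abs_mult)
  also have "\<dots> \<le> L2_set ?f I * L2_set ?g I"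
    by (rule L2_set_mult_ineq)
  also have "L2_set ?f I * L2_set ?g I \<le> (sqrt (sum e I) + c * sqrt (sum ?u I) + ?s * sqrt (sum v I)) * (sqrt (sum a I) + sqrt (sum v I))"
    using L2_set_nonneg[of ?f I] by (intro mult_mono f g) (use f in linarith, simp)
  finally have "(\<Sum>i\<in>I. ?f i * ?g i) \<le> \<dots>" .
  moreover have "(\<Sum>i\<in>I. (m + c) * ?u i) = (m + c) * sum ?u I"
    by (simp only: sum_distrib_left)
  ultimately show ?thesis
    unfolding gap_def sum_u by (simp only: sum.distrib add_le_cancel_right)
qed

lemma gap_scale:
  assumes "0 \<le> r"
  shows "gap N m c q (r * e) (r * d) (r * a) (r * v) = r * gap N m c q e d a v"
proof -
  have 1: "(r * d + q * (r * v)) / N = r * ((d + q * v) / N)"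
    by (simp add: algebra_simps add_divide_distrib)
  have 2: "sqrt r * sqrt r = r"
    using assms by simp
  let ?A = "sqrt e + c * sqrt ((d + q * v) / N) + 2 * q * sqrt ((m + c) / N) * sqrt v"
    and ?B = "sqrt a + sqrt v" and ?C = "(m + c) * ((d + q * v) / N)"
  show ?thesis
    unfolding gap_def 1 real_sqrt_mult[of r]
    by (rule trans[of _ "(sqrt r * sqrt r) * (?A * ?B) + r * ?C"], simp only: algebra_simps) (simp only: 2 distrib_left)
qed

text \<open>Superadditivity and homogeneity make \<open>gap\<close> concave, so averages over the
  answer to a classical query may be taken inside.\<close>

lemma avg_gap_le:
  fixes e a :: "'i::finite \<Rightarrow> real"
  assumes "0 < N" "0 \<le> m" "0 \<le> c" "0 \<le> q" "\<And>i. 0 \<le> e i" "0 \<le> d" "\<And>i. 0 \<le> a i" "0 \<le> v"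
  shows "avg (\<lambda>i. gap N m c q (e i) d (a i) v) \<le> gap N m c q (avg e) d (avg a) v"
proof -
  let ?r = "inverse (real CARD('i))"
  have "avg (\<lambda>i. gap N m c q (e i) d (a i) v)
      \<le> ?r * gap N m c q (sum e UNIV) (real CARD('i) * d) (sum a UNIV) (real CARD('i) * v)"
    using sum_gap_le[of UNIV N m c q e "\<lambda>_. d" a "\<lambda>_. v"] assms
    by (simp add: avg_def mult_left_mono)
  moreover have "?r * (real CARD('i) * z) = z" for z
    by simp
  ultimately show ?thesis
    by (subst (asm) gap_scale[symmetric]) (simp_all add: avg_def)
qed

text \<open>The common part of both kinds of query: \<open>m + c\<close> is preserved and the
  forecast \<open>d + q * v\<close> of the final influence does not grow, so only the first factor
  has to be compared.\<close>

lemma gap_mono: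
  assumes "0 < N" "0 \<le> m" "0 \<le> c" "0 \<le> q" "0 \<le> a" "0 \<le> v" "0 \<le> d'"
    and m: "m' + c' = m + c" and q: "0 \<le> q'" "d' + q' * v \<le> d + q * v"
    and e: "sqrt e' + c' * sqrt ((d' + q' * v) / N) + 2 * q' * sqrt ((m + c) / N) * sqrt v
      \<le> sqrt e + c * sqrt ((d + q * v) / N) + 2 * q * sqrt ((m + c) / N) * sqrt v"
  shows "gap N m' c' q' e' d' a v \<le> gap N m c q e d a v"
  unfolding gap_def m
  by (rule add_mono[OF mult_right_mono[OF e] mult_left_mono[OF divide_right_mono[OF q(2)]]])
     (use assms in auto)

text \<open>One query moves from \<open>1 + c\<close> to \<open>1 + m\<close>; its added distance is
  paid by one of the \<open>1 + c\<close> copies of \<open>sqrt ((d + q * v) / N)\<close>.\<close>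

lemma gap_classical_query:
  assumes "0 < N" "0 \<le> m" "0 \<le> c" "0 \<le> q" "0 \<le> d" "0 \<le> a" "0 \<le> v"
    and e: "sqrt e' \<le> sqrt e + sqrt (d / N)"
  shows "gap N (1 + m) c q e' d a v \<le> gap N m (1 + c) q e d a v"
proof (rule gap_mono)
  have "sqrt (d / N) \<le> sqrt ((d + q * v) / N)"
    using assms by (intro real_sqrt_le_mono divide_right_mono) auto
  with e have "sqrt e' + c * sqrt ((d + q * v) / N) \<le> sqrt e + (1 + c) * sqrt ((d + q * v) / N)"
    unfolding distrib_right mult_1 by linarith
  then show "sqrt e' + c * sqrt ((d + q * v) / N) + 2 * q * sqrt ((m + (1 + c)) / N) * sqrt v
      \<le> sqrt e + (1 + c) * sqrt ((d + q * v) / N) + 2 * q * sqrt ((m + (1 + c)) / N) * sqrt v"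
    by simp
qed (use assms in auto)

text \<open>The growth of the influence by \<open>v\<close> is already in the forecast; the added
  distance is paid by one of the \<open>1 + q\<close> terms.\<close>

lemma gap_quantum_query:
  assumes "0 < N" "0 \<le> m" "0 \<le> c" "0 \<le> q" "0 \<le> d" "0 \<le> d'" "0 \<le> a" "0 \<le> v"
    and d: "d' \<le> d + v" and e: "sqrt e' \<le> sqrt e + 2 * sqrt (m / N * v)"
  shows "gap N m c q e' d' a v \<le> gap N m c (1 + q) e d a v"
proof (rule gap_mono)
  show dv: "d' + q * v \<le> d + (1 + q) * v"
    using d by (simp add: algebra_simps)
  have "sqrt ((d' + q * v) / N) \<le> sqrt ((d + (1 + q) * v) / N)"
    using assms dv by (intro real_sqrt_le_mono divide_right_mono) auto
  then have "c * sqrt ((d' + q * v) / N) \<le> c * sqrt ((d + (1 + q) * v) / N)"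
    using assms by (intro mult_left_mono)
  moreover have "sqrt (m / N * v) \<le> sqrt ((m + c) / N) * sqrt v"
    unfolding real_sqrt_mult using assms by (intro mult_right_mono real_sqrt_le_mono divide_right_mono) auto
  ultimately show "sqrt e' + c * sqrt ((d' + q * v) / N) + 2 * q * sqrt ((m + c) / N) * sqrt v
      \<le> sqrt e + c * sqrt ((d + (1 + q) * v) / N) + 2 * (1 + q) * sqrt ((m + c) / N) * sqrt v"
    using e by (simp add: algebra_simps)
qed (use assms in auto)

section \<open>Reprogramming at translated query points\<close>

abbreviation translate :: "'n::finite bits set \<Rightarrow> 'n bits \<Rightarrow> 'n bits set"
  where "translate X k \<equiv> (\<lambda>x. x + k) ` X"

text \<open>The table \<open>t\<close> holds the answers to the classical queries in \<open>X\<close>. A pair \<open>p = (F, k)\<close> consists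
  of a function, to be reprogrammed consistently with the table, and a key.\<close>

definition reprogram ::
    "'n::finite bits set \<Rightarrow> ('n bits \<Rightarrow> 'n bits) \<Rightarrow> ('n bits \<Rightarrow> 'n bits) \<times> 'n bits \<Rightarrow> 'n bits \<Rightarrow> 'n bits"
  where "reprogram X t p = override_on (fst p) (E (snd p) t) (translate X (snd p))"

lemma reprogram_apply: "reprogram X t (F, k) z = (if z + k \<in> X then t (z + k) else F z)"
  by (simp add: reprogram_def override_on_def mem_translate_iff E_def)

lemma reprogram_fun_upd:
  "x \<notin> X \<Longrightarrow> reprogram X t (F(x + k := y), k) = reprogram (insert x X) (t(x := y)) (F, k)"
  by (rule ext) (auto simp: reprogram_apply)

lemma avg_fst [simp]: "avg (\<lambda>p :: 'a::finite \<times> 'b::finite. f (fst p)) = avg f"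
  by (simp add: avg_pair)

lemma msq_fst [simp]: "msq (\<lambda>p :: 'a::finite \<times> 'b::finite. \<psi> (fst p)) = msq \<psi>"
  unfolding msq_def by (rule avg_fst)

lemma msq_pair: "msq f = avg (\<lambda>k. msq (\<lambda>F. f (F, k)))"
  unfolding msq_def by (rule avg_pair)

lemma influence_eq_avg:
  "influence \<psi> = real CARD('a) * avg (\<lambda>s. msq (\<lambda>F. \<psi> F - resample {s} \<psi> F))"
  for \<psi> :: "('a::finite \<Rightarrow> 'b::finite) \<Rightarrow> 'c::real_inner"
  by (simp add: influence_def avg_def)

lemma msq_resample_translate_le:
  fixes \<psi> :: "('n::finite bits \<Rightarrow> 'n bits) \<Rightarrow> 'c::real_inner"
  shows "msq (\<lambda>p. resample (translate X (snd p)) \<psi> (fst p)) \<le> msq \<psi>"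
proof -
  have "msq (\<lambda>p. resample (translate X (snd p)) \<psi> (fst p)) \<le> avg (\<lambda>k :: 'n bits. msq \<psi>)"
    unfolding msq_pair fst_conv snd_conv by (intro avg_mono msq_resample_le)
  then show ?thesis by simp
qed

lemma msq_resample_translate_loss:
  fixes \<psi> :: "('n::finite bits \<Rightarrow> 'n bits) \<Rightarrow> 'c::real_inner"
  shows "msq \<psi> - msq (\<lambda>p. resample (translate X (snd p)) \<psi> (fst p))
    \<le> real (card X) * (influence \<psi> / real CARD('n bits))"
proof -
  have "msq \<psi> - msq (\<lambda>p. resample (translate X (snd p)) \<psi> (fst p))
      = avg (\<lambda>k. msq \<psi> - msq (resample (translate X k) \<psi>))"
    by (simp add: msq_pair avg_diff)
  also have "\<dots> \<le> avg (\<lambda>k. \<Sum>s\<in>translate X k. msq (\<lambda>F. \<psi> F - resample {s} \<psi> F))"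
    by (intro avg_mono msq_resample_loss)
  finally show ?thesis
    unfolding avg_sum_translate influence_eq_avg by simp
qed

text \<open>The additional point \<open>x + k\<close> is uniform, so resampling it costs, in mean
  square, at most the average of the influences of single points.\<close>

lemma distance_classical_query:
  fixes \<psi> :: "('n::finite bits \<Rightarrow> 'n bits) \<Rightarrow> 'c::real_inner"
  shows "sqrt (msq (\<lambda>p. \<alpha> p - resample (translate (insert x X) (snd p)) \<psi> (fst p)))
    \<le> sqrt (msq (\<lambda>p. \<alpha> p - resample (translate X (snd p)) \<psi> (fst p))) + sqrt (influence \<psi> / real CARD('n bits))"
proof -
  let ?h = "\<lambda>s. msq (\<lambda>F. \<psi> F - resample {s} \<psi> F)"
  have "msq (\<lambda>p. resample (translate X (snd p)) \<psi> (fst p) - resample (translate (insert x X) (snd p)) \<psi> (fst p))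
      \<le> avg (\<lambda>k. ?h (x + k))"
    unfolding msq_pair fst_conv snd_conv image_insert by (intro avg_mono msq_resample_insert_le)
  also have "\<dots> = avg ?h"
    using avg_bij[OF bij_plus, of ?h x] .
  finally have "sqrt (msq (\<lambda>p. resample (translate X (snd p)) \<psi> (fst p)
      - resample (translate (insert x X) (snd p)) \<psi> (fst p))) \<le> sqrt (influence \<psi> / real CARD('n bits))"
    by (simp add: influence_eq_avg)
  moreover note sqrt_msq_triangle[of "\<lambda>p. \<alpha> p - resample (translate X (snd p)) \<psi> (fst p)"
      "\<lambda>p. resample (translate X (snd p)) \<psi> (fst p) - resample (translate (insert x X) (snd p)) \<psi> (fst p)"]
  ultimately show ?thesis
    unfolding add_diff_eq diff_add_cancel by linarith
qed

text \<open>The hybrid is the real query applied to the resampled ideal state. Unitarity preserves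
  the old distance up to it (\<open>?e\<close>); beyond it (\<open>?f\<close>) the query functions
  differ only on \<open>translate X k\<close>.\<close>

lemma distance_quantum_query:
  fixes \<psi> :: "('n::finite bits \<Rightarrow> 'n bits) \<Rightarrow> ('n, 'w::finite) state"
  shows "sqrt (msq (\<lambda>p. query_unitary (reprogram X t p) *v \<alpha> p
      - resample (translate X (snd p)) (\<lambda>F. query_unitary F *v \<psi> F) (fst p)))
    \<le> sqrt (msq (\<lambda>p. \<alpha> p - resample (translate X (snd p)) \<psi> (fst p)))
      + 2 * sqrt (real (card X) / real CARD('n bits) * msq \<psi>)"
proof -
  let ?r = "reprogram X t" and ?S = "\<lambda>p. translate X (snd p)"
  let ?w = "\<lambda>k F. \<Sum>x\<in>translate X k. query_weight (\<psi> F) x"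
  let ?e = "\<lambda>p. query_unitary (?r p) *v (\<alpha> p - resample (?S p) \<psi> (fst p))"
  let ?f = "\<lambda>p. query_unitary (?r p) *v resample (?S p) \<psi> (fst p)
      - resample (?S p) (\<lambda>F. query_unitary F *v \<psi> F) (fst p)"
  have "(norm (?f (F, k)))\<^sup>2 \<le> avg (\<lambda>G. 4 * ?w k (override_on F G (translate X k)))" for F k
  proof -
    let ?FG = "\<lambda>G. override_on F G (translate X k)"
    \<comment> \<open>\<open>?r (F, k)\<close> does not depend on \<open>G\<close>, so its query
      unitary can enter the average over \<open>G\<close>.\<close>
    have "?f (F, k) = avg (\<lambda>G. query_unitary (?r (F, k)) *v \<psi> (?FG G) - query_unitary (?FG G) *v \<psi> (?FG G))"
      by (simp add: resample_def avg_diff avg_linear[OF linear_matrix_vector_mult])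
    then have "(norm (?f (F, k)))\<^sup>2
        \<le> avg (\<lambda>G. (norm (query_unitary (?r (F, k)) *v \<psi> (?FG G) - query_unitary (?FG G) *v \<psi> (?FG G)))\<^sup>2)"
      by (simp only: norm_avg_le[unfolded msq_def])
    also have "\<dots> \<le> avg (\<lambda>G. 4 * ?w k (?FG G))"
      by (intro avg_mono norm_query_unitary_diff) (simp add: reprogram_def)
    finally show ?thesis .
  qed
  then have "msq ?f \<le> avg (\<lambda>k. avg (\<lambda>F. avg (\<lambda>G. 4 * ?w k (override_on F G (translate X k)))))"
    unfolding msq_def avg_pair[of "\<lambda>p. (norm (?f p))\<^sup>2"] by (intro avg_mono)
  also have "\<dots> = avg (\<lambda>k. avg (\<lambda>F. 4 * ?w k F))"
    by (simp only: avg_override_on[where h = "\<lambda>F. 4 * ?w _ F"])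
  \<comment> \<open>With \<open>F\<close> fixed first, the key is uniform independently of
    \<open>\<psi> F\<close>.\<close>
  also have "\<dots> = avg (\<lambda>F. avg (\<lambda>k. 4 * ?w k F))"
    by (rule avg_swap)
  also have "\<dots> = avg (\<lambda>F. 4 * (real (card X) * avg (query_weight (\<psi> F))))"
    by (simp add: avg_sum_translate avg_linear[where h = "(*) (4::real)", symmetric] linear_times)
  also have "\<dots> = avg (\<lambda>F. (4 * (real (card X) / real CARD('n bits))) * (norm (\<psi> F))\<^sup>2)"
    by (simp add: avg_def sum_query_weight divide_inverse mult_ac)
  also have "\<dots> = 2\<^sup>2 * (real (card X) / real CARD('n bits) * msq \<psi>)"
    by (subst avg_linear[where h = "(*) (4 * (real (card X) / real CARD('n bits)))", symmetric])
       (simp_all add: linear_times msq_def)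
  finally have "sqrt (msq ?f) \<le> sqrt (2\<^sup>2 * (real (card X) / real CARD('n bits) * msq \<psi>))"
    by (rule real_sqrt_le_mono)
  also have "\<dots> = 2 * sqrt (real (card X) / real CARD('n bits) * msq \<psi>)"
    by (subst real_sqrt_mult) simp
  finally have "sqrt (msq ?f) \<le> 2 * sqrt (real (card X) / real CARD('n bits) * msq \<psi>)" .
  moreover have "sqrt (msq ?e) = sqrt (msq (\<lambda>p. \<alpha> p - resample (?S p) \<psi> (fst p)))"
    by (simp add: msq_def)
  moreover have split: "(\<lambda>p. query_unitary (?r p) *v \<alpha> p - resample (?S p) (\<lambda>F. query_unitary F *v \<psi> F) (fst p))
      = (\<lambda>p. ?e p + ?f p)"
    by (simp add: matrix_vector_mult_diff_distrib)
  ultimately show ?thesis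
    using sqrt_msq_triangle[of ?e ?f] unfolding split by linarith
qed

section \<open>Induction over the decision tree\<close>

text \<open>For the induction \<open>\<alpha>\<close> and \<open>\<psi>\<close> are arbitrary; their
  relation enters only through the distance in \<open>gap\<close>. In the real average
  \<open>snd p\<close> is the key, in the ideal one it is the random function, with the answers in
  \<open>t\<close> forced on \<open>X\<close>.\<close>

lemma bias_gap:
  fixes A :: "('n::finite, 'w::finite, 'o::finite) algorithm"
    and \<alpha> :: "('n bits \<Rightarrow> 'n bits) \<times> 'n bits \<Rightarrow> ('n, 'w) state"
  assumes "well_formed A" "classical_queries A \<le> c" "quantum_queries A \<le> q"
  shows "\<bar>avg (\<lambda>p. bias A (\<alpha> p) (E (snd p) (reprogram X t p)) (reprogram X t p))
      - avg (\<lambda>p. bias A (\<psi> (fst p)) (override_on (snd p) t X) (fst p))\<bar>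
    \<le> gap (real CARD('n bits)) (real (card X)) (real c) (real q)
        (msq (\<lambda>p. \<alpha> p - resample (translate X (snd p)) \<psi> (fst p))) (influence \<psi>) (msq \<alpha>) (msq \<psi>)"
  using assms
proof (induction A arbitrary: X t \<alpha> \<psi> c q)
  case (Output b)
  let ?\<sigma> = "if b then 1 else - 1 :: real"
  let ?\<beta> = "\<lambda>p. resample (translate X (snd p)) \<psi> (fst p)"
  let ?e = "msq (\<lambda>p. \<alpha> p - ?\<beta> p)" and ?N = "real CARD('n bits)"
  \<comment> \<open>The reverse triangle inequality leads from \<open>\<alpha>\<close> to
    \<open>?\<beta>\<close>; the rest of the way to \<open>\<psi>\<close> is the squared norm lost
    by resampling.\<close>
  have "\<bar>sqrt (msq \<alpha>) - sqrt (msq ?\<beta>)\<bar> \<le> sqrt ?e"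
  proof -
    have "msq (\<lambda>p. ?\<beta> p - \<alpha> p) = ?e"
      by (simp add: msq_def norm_minus_commute)
    then show ?thesis
      using sqrt_msq_triangle[of "\<lambda>p. \<alpha> p - ?\<beta> p" ?\<beta>] sqrt_msq_triangle[of "\<lambda>p. ?\<beta> p - \<alpha> p" \<alpha>]
      by simp
  qed
  moreover have "sqrt (msq ?\<beta>) \<le> sqrt (msq \<psi>)"
    using msq_resample_translate_le by (rule real_sqrt_le_mono)
  ultimately have "\<bar>sqrt (msq \<alpha>) - sqrt (msq ?\<beta>)\<bar> * (sqrt (msq \<alpha>) + sqrt (msq ?\<beta>))
      \<le> sqrt ?e * (sqrt (msq \<alpha>) + sqrt (msq \<psi>))"
    by (intro mult_mono) auto
  moreover have "\<bar>sqrt (msq \<alpha>) - sqrt (msq ?\<beta>)\<bar> * (sqrt (msq \<alpha>) + sqrt (msq ?\<beta>)) = \<bar>msq \<alpha> - msq ?\<beta>\<bar>"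
  proof -
    have "msq \<alpha> - msq ?\<beta> = (sqrt (msq \<alpha>) - sqrt (msq ?\<beta>)) * (sqrt (msq \<alpha>) + sqrt (msq ?\<beta>))"
      by (simp add: algebra_simps)
    then show ?thesis
      by (simp add: abs_mult)
  qed
  ultimately have "\<bar>msq \<alpha> - msq \<psi>\<bar>
      \<le> sqrt ?e * (sqrt (msq \<alpha>) + sqrt (msq \<psi>)) + real (card X) * (influence \<psi> / ?N)"
    using msq_resample_translate_loss[of \<psi> X] msq_resample_translate_le[of X \<psi>] by linarith
  also have "\<dots> \<le> gap ?N (real (card X)) (real c) (real q) ?e (influence \<psi>) (msq \<alpha>) (msq \<psi>)"
    by (intro gap_ge) auto
  finally have bound: "\<bar>msq \<alpha> - msq \<psi>\<bar> \<le> \<dots>" .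
  have "avg (\<lambda>p. ?\<sigma> * (norm (\<alpha> p))\<^sup>2) - avg (\<lambda>p :: _ \<times> ('n bits \<Rightarrow> 'n bits). ?\<sigma> * (norm (\<psi> (fst p)))\<^sup>2)
      = ?\<sigma> * (msq \<alpha> - msq \<psi>)"
    unfolding avg_fst[of "\<lambda>F. ?\<sigma> * (norm (\<psi> F))\<^sup>2"] by (simp add: msq_def avg_def sum_negf)
  with bound show ?case
    by (simp add: abs_mult)
next
  case (Measure K g)
  let ?N = "real CARD('n bits)" and ?m = "real (card X)" and ?c = "real c" and ?q = "real q"
  let ?\<beta> = "\<lambda>p. resample (translate X (snd p)) \<psi> (fst p)"
  let ?\<alpha> = "\<lambda>i p. K i *v \<alpha> p" and ?\<psi> = "\<lambda>i F. K i *v \<psi> F"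
  let ?real = "\<lambda>i. avg (\<lambda>p. bias (g i) (?\<alpha> i p) (E (snd p) (reprogram X t p)) (reprogram X t p))"
  let ?ideal = "\<lambda>i. avg (\<lambda>p. bias (g i) (?\<psi> i (fst p)) (override_on (snd p) t X) (fst p))"
  let ?gap = "\<lambda>i. gap ?N ?m ?c ?q (msq (\<lambda>p. K i *v (\<alpha> p - ?\<beta> p)))
      (influence (?\<psi> i)) (msq (?\<alpha> i)) (msq (?\<psi> i))"
  have K: "(\<Sum>i\<in>UNIV. dagger (K i) ** K i) = mat 1"
    using Measure.prems by simp
  have "\<bar>?real i - ?ideal i\<bar> \<le> ?gap i" for i
  proof -
    have "classical_queries (g i) \<le> c" "quantum_queries (g i) \<le> q"
      using Measure.prems by auto
    then show ?thesis
      using Measure.IH[of "g i" c q "?\<alpha> i" X t "?\<psi> i"] Measure.prems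
      by (simp add: resample_linear[OF linear_matrix_vector_mult] matrix_vector_mult_diff_distrib)
  qed
  then have "\<bar>(\<Sum>i\<in>UNIV. ?real i) - (\<Sum>i\<in>UNIV. ?ideal i)\<bar> \<le> (\<Sum>i\<in>UNIV. ?gap i)"
    unfolding sum_subtractf[symmetric] by (intro order_trans[OF sum_abs] sum_mono)
  also have "\<dots> \<le> gap ?N ?m ?c ?q (\<Sum>i\<in>UNIV. msq (\<lambda>p. K i *v (\<alpha> p - ?\<beta> p)))
      (\<Sum>i\<in>UNIV. influence (?\<psi> i)) (\<Sum>i\<in>UNIV. msq (?\<alpha> i)) (\<Sum>i\<in>UNIV. msq (?\<psi> i))"
    by (intro sum_gap_le) auto
  finally show ?case
    by (simp add: avg_sum sum_msq_measurement[OF K] sum_influence_measurement[OF K])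
next
  case (Classical_Query x g)
  let ?N = "real CARD('n bits)"
  obtain c' where c': "c = Suc c'"
    using Classical_Query.prems by (cases c) auto
  have IH_prems: "well_formed (g y)" "classical_queries (g y) \<le> c'" "quantum_queries (g y) \<le> q" for y
    using Classical_Query.prems c' by auto
  show ?case
  proof (cases "x \<in> X")
    \<comment> \<open>A repeated query is answered from the table in both runs, so the whole
      allowance \<open>c\<close> is passed on.\<close>
    case True
    have "classical_queries (g (t x)) \<le> c"
      using IH_prems(2)[of "t x"] c' by simp
    moreover have "E (snd p) (reprogram X t p) x = t x" for p
      using True by (cases p) (simp add: E_def reprogram_apply)
    ultimately show ?thesis
      using Classical_Query.IH[of "g (t x)" c q \<alpha> X t \<psi>] IH_prems True by simp
  next
    case False
    let ?X = "insert x X" and ?t = "\<lambda>y. t(x := y)"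
    let ?\<alpha> = "\<lambda>y p. \<alpha> ((fst p)(x + snd p := y), snd p)"
    let ?\<beta> = "\<lambda>p. resample (translate ?X (snd p)) \<psi> (fst p)"
    let ?real = "\<lambda>y. avg (\<lambda>p. bias (g y) (?\<alpha> y p) (E (snd p) (reprogram ?X (?t y) p)) (reprogram ?X (?t y) p))"
    let ?ideal = "\<lambda>y. avg (\<lambda>p. bias (g y) (\<psi> (fst p)) (override_on (snd p) (?t y) ?X) (fst p))"
    let ?gap = "gap ?N (real (card ?X)) (real c') (real q)"
    \<comment> \<open>For each key the value of \<open>F\<close> at \<open>x + k\<close>, which is
      the real answer to a new query, is drawn separately as \<open>y\<close> and averaged
      outermost.\<close>
    have split: "avg h = avg (\<lambda>y. avg (\<lambda>p. h ((fst p)(x + snd p := y), snd p)))"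
      for h :: "('n bits \<Rightarrow> 'n bits) \<times> 'n bits \<Rightarrow> real"
      using avg_fun_upd[of "\<lambda>_ F. h (F, _)"]
      by (simp add: avg_pair avg_swap[of "\<lambda>y k. avg (\<lambda>F. h (F(x + k := y), k))"])
    have "avg (\<lambda>p. bias (g (E (snd p) (reprogram X t p) x)) (\<alpha> p) (E (snd p) (reprogram X t p)) (reprogram X t p))
        = avg ?real"
    proof -
      have "reprogram ?X (?t y) p (x + snd p) = y" for y p
        by (cases p) (simp add: reprogram_apply)
      with False show ?thesis
        by (subst split) (simp add: E_def reprogram_fun_upd)
    qed
    moreover have "avg (\<lambda>p. bias (g (override_on (snd p) t X x)) (\<psi> (fst p)) (override_on (snd p) t X) (fst p))
        = avg ?ideal"
    proof -
      \<comment> \<open>The ideal answer is split off from \<open>R\<close> at \<open>x\<close>,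
        which leaves \<open>F\<close> and hence \<open>\<psi>\<close> untouched.\<close>
      have *: "override_on (R(x := y)) t X = override_on R (?t y) ?X" for R y
        using False by (auto simp: override_on_def)
      show ?thesis
        using False avg_fun_upd[of "\<lambda>y R. avg (\<lambda>F. bias (g y) (\<psi> F) (override_on R t X) F)" x]
        by (simp add: avg_pair *)
    qed
    moreover have "\<bar>avg ?real - avg ?ideal\<bar> \<le> avg (\<lambda>y. ?gap (msq (\<lambda>p. ?\<alpha> y p - ?\<beta> p)) (influence \<psi>) (msq (?\<alpha> y)) (msq \<psi>))"
      unfolding avg_diff[symmetric]
      by (intro order_trans[OF abs_avg_le] avg_mono Classical_Query.IH IH_prems) simp
    moreover have "\<dots> \<le> ?gap (avg (\<lambda>y. msq (\<lambda>p. ?\<alpha> y p - ?\<beta> p))) (influence \<psi>) (avg (\<lambda>y. msq (?\<alpha> y))) (msq \<psi>)"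
      by (intro avg_gap_le) auto
    moreover have "avg (\<lambda>y. msq (?\<alpha> y)) = msq \<alpha>"
      unfolding msq_def by (rule split[symmetric])
    moreover have "avg (\<lambda>y. msq (\<lambda>p. ?\<alpha> y p - ?\<beta> p)) = msq (\<lambda>p. \<alpha> p - ?\<beta> p)"
    proof -
      have "resample (translate ?X k) \<psi> (F(x + k := y)) = resample (translate ?X k) \<psi> F" for F k y
        by (rule resample_cong) auto
      then show ?thesis
        unfolding msq_def by (subst split) simp
    qed
    moreover have "?gap (msq (\<lambda>p. \<alpha> p - ?\<beta> p)) (influence \<psi>) (msq \<alpha>) (msq \<psi>)
        \<le> gap ?N (real (card X)) (real c) (real q)
          (msq (\<lambda>p. \<alpha> p - resample (translate X (snd p)) \<psi> (fst p))) (influence \<psi>) (msq \<alpha>) (msq \<psi>)"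
    proof -
      have "real (card ?X) = 1 + real (card X)" "real c = 1 + real c'"
        using False c' by simp_all
      then show ?thesis
        by (simp only:) (intro gap_classical_query distance_classical_query; simp)
    qed
    ultimately show ?thesis
      by simp
  qed
next
  case (Quantum_Query A)
  let ?N = "real CARD('n bits)"
  let ?\<alpha> = "\<lambda>p. query_unitary (reprogram X t p) *v \<alpha> p" and ?\<psi> = "\<lambda>F. query_unitary F *v \<psi> F"
  obtain q' where q': "q = Suc q'"
    using Quantum_Query.prems by (cases q) auto
  have "msq ?\<alpha> = msq \<alpha>" "msq ?\<psi> = msq \<psi>"
    by (simp_all add: msq_def)
  then have "gap ?N (real (card X)) (real c) (real q')
        (msq (\<lambda>p. ?\<alpha> p - resample (translate X (snd p)) ?\<psi> (fst p))) (influence ?\<psi>) (msq ?\<alpha>) (msq ?\<psi>)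
      \<le> gap ?N (real (card X)) (real c) (1 + real q')
        (msq (\<lambda>p. \<alpha> p - resample (translate X (snd p)) \<psi> (fst p))) (influence \<psi>) (msq \<alpha>) (msq \<psi>)"
    by (simp only:) (intro gap_quantum_query influence_query_unitary distance_quantum_query; simp)
  moreover have "\<bar>avg (\<lambda>p. bias A (?\<alpha> p) (E (snd p) (reprogram X t p)) (reprogram X t p))
        - avg (\<lambda>p. bias A (?\<psi> (fst p)) (override_on (snd p) t X) (fst p))\<bar>
      \<le> gap ?N (real (card X)) (real c) (real q')
        (msq (\<lambda>p. ?\<alpha> p - resample (translate X (snd p)) ?\<psi> (fst p))) (influence ?\<psi>) (msq ?\<alpha>) (msq ?\<psi>)"
    using Quantum_Query.prems q' by (intro Quantum_Query.IH) auto
  ultimately show ?case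
    by (simp add: q')
qed

section \<open>The bound on the distinguishing advantage\<close>

theorem theorem4:
  fixes A :: "('n::finite, 'w::finite, 'o::finite) algorithm"
    and \<psi> :: "('n, 'w) state"
    and q\<^sub>E q\<^sub>F :: nat
  assumes "well_formed A"
    and "norm \<psi> = 1"
    and "classical_queries A \<le> q\<^sub>E"
    and "quantum_queries A \<le> q\<^sub>F"
  shows "\<bar>pmf (do { k \<leftarrow> pmf_of_set (UNIV :: 'n bits set);
                    F \<leftarrow> pmf_of_set (UNIV :: ('n bits \<Rightarrow> 'n bits) set);
                    run A \<psi> (E k F) F }) True
          - pmf (do { R \<leftarrow> pmf_of_set (UNIV :: ('n bits \<Rightarrow> 'n bits) set);
                      F \<leftarrow> pmf_of_set (UNIV :: ('n bits \<Rightarrow> 'n bits) set);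
                      run A \<psi> R F }) True\<bar>
         \<le> 2 powr (- (real CARD('n) / 2)) *
            (2 * real q\<^sub>E * sqrt (real q\<^sub>F) + 2 * real q\<^sub>F * sqrt (real q\<^sub>E))"
    (is "\<bar>?real - ?ideal\<bar> \<le> ?bound")
proof -
  let ?N = "real CARD('n bits)"
  let ?u = "real q\<^sub>E * sqrt (real q\<^sub>F / ?N)" and ?v = "real q\<^sub>F * sqrt (real q\<^sub>E / ?N)"
  have N: "?N = 2 ^ CARD('n)"
    by (simp add: card_bit)
  have "sqrt ?N = (2 powr real CARD('n)) powr (1 / 2)"
    unfolding N by (simp add: powr_half_sqrt powr_realpow)
  then have "2 powr (- (real CARD('n) / 2)) = 1 / sqrt ?N"
    by (simp add: powr_minus_divide powr_powr)
  then have bound: "?bound = 2 * ?u + 2 * ?v"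
    by (simp add: real_sqrt_divide add_divide_distrib)
  have run: "bias A \<psi> O1 O2 = 2 * pmf (run A \<psi> O1 O2) True - 1" for O1 O2
    using assms by (intro bias_eq_run)
  have *: "avg (\<lambda>x. 2 * f x - 1) = 2 * avg f - 1" for f :: "'i::finite \<Rightarrow> real"
    using avg_linear[of "(*) 2" f] by (simp add: avg_diff linear_times)
  have real: "avg (\<lambda>p. bias A \<psi> (E (snd p) (reprogram {} (\<lambda>_. 0) p)) (reprogram {} (\<lambda>_. 0) p)) = 2 * ?real - 1"
    by (simp add: reprogram_def run avg_pair * pmf_bind_pmf_of_set_UNIV)
  have ideal: "avg (\<lambda>p. bias A \<psi> (override_on (snd p) (\<lambda>_. 0) {}) (fst p)) = 2 * ?ideal - 1"
    by (simp add: run avg_pair * pmf_bind_pmf_of_set_UNIV)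
  define \<delta> where "\<delta> = \<bar>?real - ?ideal\<bar>"
  \<comment> \<open>Initially the table is empty and both states are the constant
    \<open>\<psi>\<close>, so distance and influence are 0 and both squared norms are 1.\<close>
  have "\<bar>(2 * ?real - 1) - (2 * ?ideal - 1)\<bar> \<le> gap ?N 0 (real q\<^sub>E) (real q\<^sub>F) 0 0 1 1"
    using bias_gap[OF assms(1,3,4), of "\<lambda>_. \<psi>" "{}" "\<lambda>_. 0" "\<lambda>_. \<psi>"] assms(2)
    unfolding real ideal
    by (simp add: msq_def resample_def influence_def)
  also have "\<dots> = 2 * ?u + 4 * ?v + real q\<^sub>E * (real q\<^sub>F / ?N)"
    by (simp add: gap_def)
  also have "\<bar>(2 * x - 1) - (2 * y - 1)\<bar> = 2 * \<bar>x - y\<bar>" for x y :: real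
    by (simp add: abs_if)
  finally have main: "2 * \<delta> \<le> 2 * ?u + 4 * ?v + real q\<^sub>E * (real q\<^sub>F / ?N)"
    unfolding \<delta>_def .
  have "\<delta> \<le> 2 * ?u + 2 * ?v"
  \<comment> \<open>If \<open>q\<^sub>F \<le> ?N\<close>, the last summand is at most
    \<open>?u\<close>, since t \<le> sqrt t on [0, 1]; if \<open>q\<^sub>E = 0\<close>, it vanishes.
    Otherwise \<open>?u\<close> is at least 1 and the bound is trivial.\<close>
  proof (cases "real q\<^sub>F \<le> ?N \<or> q\<^sub>E = 0")
    case True
    have "real q\<^sub>E * (real q\<^sub>F / ?N) \<le> ?u"
    proof (cases "q\<^sub>E = 0")
      case False
      with True have "real q\<^sub>F / ?N \<le> 1"
        by (simp add: divide_le_eq)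
      then have "(real q\<^sub>F / ?N)\<^sup>2 \<le> real q\<^sub>F / ?N"
        unfolding power2_eq_square by (intro mult_left_le) auto
      then have "real q\<^sub>F / ?N \<le> sqrt (real q\<^sub>F / ?N)"
        by (rule real_le_rsqrt)
      then show ?thesis
        by (intro mult_left_mono) auto
    qed simp
    moreover have "0 \<le> ?u"
      by simp
    ultimately show ?thesis
      using main by linarith
  next
    case False
    then have "1 \<le> real q\<^sub>F / ?N"
      by (simp add: le_divide_eq)
    then have "1 * 1 \<le> ?u"
      using False by (intro mult_mono) auto
    moreover have "0 \<le> ?v"
      by simp
    moreover have "\<delta> \<le> 1"
    proof -
      have "\<bar>x - y\<bar> \<le> 1" if "0 \<le> x" "x \<le> 1" "0 \<le> y" "y \<le> 1" for x y :: real
        using that by linarith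
      then show ?thesis
        by (simp only: \<delta>_def pmf_nonneg pmf_le_1)
    qed
    ultimately show ?thesis
      by linarith
  qed
  then show ?thesis
    by (simp only: bound \<delta>_def)
qed

end
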